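(* Consider the MGU network composed of $L$ stacked MGU layers, with initial hidden states in $[-1,1]^{n_h^{(l)}}$ for every layer $l\in\{1,\dots,L\}$ and inputs $\boldsymbol u_k\in\mathcal U=[-1,1]^{n_u}$ for all $k\in\mathbb N$. For each $l$ let $$\bar\sigma_f^{(l)}:=\sigma\left(\left\|\begin{bmatrix}W_f^{(l)} & R_f^{(l)} & \boldsymbol b_f^{(l)}\end{bmatrix}\right\|\right),\qquad \bar\phi_{\tilde h}^{(l)}:=\phi\left(\left\|\begin{bmatrix}W_{\tilde h}^{(l)} & R_{\tilde h}^{(l)} & \boldsymbol b_{\tilde h}^{(l)}\end{bmatrix}\right\|\right).$$ If $$\bar\sigma_f^{(l)}+\big(\bar\sigma_f^{(l)}\big)^2\|R_{\tilde h}^{(l)}\|+\tfrac14\|R_f^{(l)}\|\left(\bar\sigma_f^{(l)}\|R_{\tilde h}^{(l)}\|+\bar\phi_{\tilde h}^{(l)}+1\right)<1$$ holds for every layer $l\in\{1,\dots,L\}$, then the MGU network is $\delta$ISS in $\mathcal H_{\mathrm{inv}}=\prod_{l=1}^L[-1,1]^{n_h^{(l)}}$ with respect to $\mathcal U$.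
   Context: Notation: $\mathbb N$ includes $0$; $\|\cdot\|$ is the infinity norm of vectors and the induced infinity norm of matrices (maximum absolute row sum); $\circ$ is the element-wise product; $\sigma(x)=1/(1+e^{-x})$ and $\phi(x)=\tanh(x)$; bold $\boldsymbol\sigma,\boldsymbol\phi$ denote component-wise application; $\boldsymbol 1_n$ is the all-ones vector; $[A\ B\ C]$ is horizontal concatenation. MGU network: layer $l\in\{1,\dots,L\}$ has hidden state $\boldsymbol h_k^{(l)}\in\mathbb R^{n_h^{(l)}}$ and input $\tilde{\boldsymbol u}_k^{(l)}\in\mathbb R^{n_{\tilde u}^{(l)}}$, where $\tilde{\boldsymbol u}_k^{(1)}=\boldsymbol u_k\in\mathbb R^{n_u}$ and $\tilde{\boldsymbol u}_k^{(l)}=\boldsymbol h_{k+1}^{(l-1)}$ for $l\ge2$ (so $n_{\tilde u}^{(1)}=n_u$, $n_{\tilde u}^{(l)}=n_h^{(l-1)}$ for $l\ge 2$), and $$\boldsymbol f_k^{(l)}=\boldsymbol\sigma(W_f^{(l)}\tilde{\boldsymbol u}_k^{(l)}+R_f^{(l)}\boldsymbol h_k^{(l)}+\boldsymbol b_f^{(l)}),$$ $$\tilde{\boldsymbol h}_k^{(l)}=\boldsymbol\phi(W_{\tilde h}^{(l)}\tilde{\boldsymbol u}_k^{(l)}+R_{\tilde h}^{(l)}(\boldsymbol f_k^{(l)}\circ\boldsymbol h_k^{(l)})+\boldsymbol b_{\tilde h}^{(l)}),$$ $$\boldsymbol h_{k+1}^{(l)}=(\boldsymbol 1_{n_h^{(l)}}-\boldsymbol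 f_k^{(l)})\circ\boldsymbol h_k^{(l)}+\boldsymbol f_k^{(l)}\circ\tilde{\boldsymbol h}_k^{(l)},$$ where $W_f^{(l)},W_{\tilde h}^{(l)}\in\mathbb R^{n_h^{(l)}\times n_{\tilde u}^{(l)}}$, $R_f^{(l)},R_{\tilde h}^{(l)}\in\mathbb R^{n_h^{(l)}\times n_h^{(l)}}$, $\boldsymbol b_f^{(l)},\boldsymbol b_{\tilde h}^{(l)}\in\mathbb R^{n_h^{(l)}}$. The output is $\boldsymbol y_k=W_y\boldsymbol h_{k+1}^{(L)}+\boldsymbol b_y$ (irrelevant for state stability). The network state is $\boldsymbol h_k=[\boldsymbol h_k^{(1)\top},\dots,\boldsymbol h_k^{(L)\top}]^\top$, which evolves as a system with input $\boldsymbol u_k$. Comparison functions: $\gamma:\mathbb R_{\ge0}\to\mathbb R_{\ge0}$ is class $\mathcal K$ if continuous, strictly increasing, $\gamma(0)=0$; class $\mathcal K_\infty$ if moreover $\gamma(r)\to\infty$ as $r\to\infty$. A continuous $\psi:\mathbb R_{\ge0}\times\mathbb N\to\mathbb R_{\ge0}$ is class $\mathcal{KL}$ if $\psi(\cdot,k)\in\mathcal K$ for each fixed $k$ and, for each fixed $r>0$, $\psi(r,k)$ is strictly decreasing to zero as $k\to\infty$. $\delta$ISS: a system $\boldsymbol x_{k+1}=\boldsymbol w(\boldsymbol x_k,\boldsymbol u_k)$ is $\delta$ISS (incrementally input-to-state stable) in a compact forward invariant set $\mathcal X$ with respect to a compact set $\mathcal U$ if there exist $\psi_\delta\in\mathcal{KL}$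 and $\gamma_{\delta u}\in\mathcal K_\infty$ such that for any $k\in\mathbb N$, any $\boldsymbol x_0^{\mathrm a},\boldsymbol x_0^{\mathrm b}\in\mathcal X$, and any input sequences $\{\boldsymbol u_z^{\mathrm a}\in\mathcal U\}_{z=0}^{k-1}$, $\{\boldsymbol u_z^{\mathrm b}\in\mathcal U\}_{z=0}^{k-1}$, the corresponding state trajectories satisfy $$\|\boldsymbol x_k^{\mathrm a}-\boldsymbol x_k^{\mathrm b}\|\le\psi_\delta(\|\boldsymbol x_0^{\mathrm a}-\boldsymbol x_0^{\mathrm b}\|,k)+\gamma_{\delta u}\Big(\max_{0\le z<k}\|\boldsymbol u_z^{\mathrm a}-\boldsymbol u_z^{\mathrm b}\|\Big),$$ with the maximum over an empty set taken to be $0$. For the MGU network, $\boldsymbol x_k=\boldsymbol h_k$. *)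

theory Defs
  imports "HOL-Analysis.Abstract_Metric_Spaces" "Jordan_Normal_Form.Matrix"
begin

(* vec and $ denote the vectors of Jordan_Normal_Form.Matrix, not those of HOL-Analysis. *)
hide_type (open) Finite_Cartesian_Product.vec
hide_const (open) Finite_Cartesian_Product.vec
unbundle no vec_syntax

section \<open>Infinity norms on vectors and matrices\<close>

(* All maximised quantities are nonnegative, so inserting 0 only matters for an empty
   index set, where the maximum is read as 0. *)

definition vnorm :: "real vec \<Rightarrow> real" where
  "vnorm v = Max (insert 0 ((\<lambda>i. \<bar>v $ i\<bar>) ` {..<dim_vec v}))"

definition mnorm :: "real mat \<Rightarrow> real" where
  "mnorm A = Max (insert 0 ((\<lambda>i. \<Sum>j<dim_col A. \<bar>A $$ (i, j)\<bar>) ` {..<dim_row A}))"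

(* Metric_space requires symmetry on the whole type, whereas the difference of two vectors of
   different dimension takes the dimension of the second one; hence the case distinction.
   Only vectors of equal dimension matter. *)
definition vdist :: "real vec \<Rightarrow> real vec \<Rightarrow> real" where
  "vdist x y = (if dim_vec x = dim_vec y then vnorm (x - y) else 0)"

definition vec_topology :: "nat \<Rightarrow> real vec topology" where
  "vec_topology n = Metric_space.mtopology (carrier_vec n) vdist"

lemma vnorm_nonneg: "0 \<le> vnorm v"
  unfolding vnorm_def by (intro Max_ge) auto

lemma vnorm_le_iff: "0 \<le> c \<Longrightarrow> vnorm v \<le> c \<longleftrightarrow> (\<forall>i<dim_vec v. \<bar>v $ i\<bar> \<le> c)"
  unfolding vnorm_def by (subst Max_le_iff) auto

lemma abs_index_le_vnorm: "i < dim_vec v \<Longrightarrow> \<bar>v $ i\<bar> \<le> vnorm v"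
  using vnorm_le_iff[OF vnorm_nonneg, of v v] by auto

lemma Metric_space_vdist: "Metric_space (carrier_vec n) vdist"
proof
  show "0 \<le> vdist x y" for x y
    by (simp add: vdist_def vnorm_nonneg)
  show "vdist x y = vdist y x" for x y
  proof -
    have "vdist x y \<le> vdist y x" for x y
    proof (cases "dim_vec x = dim_vec y")
      case True
      have "\<bar>(x - y) $ i\<bar> \<le> vnorm (y - x)" if "i < dim_vec x" for i
        using abs_index_le_vnorm[of i "y - x"] that True by (simp add: abs_minus_commute)
      then show ?thesis
        using True by (simp add: vdist_def vnorm_le_iff vnorm_nonneg)
    qed (simp add: vdist_def)
    then show ?thesis
      by (intro antisym)
  qed
  show "vdist x y = 0 \<longleftrightarrow> x = y" if "x \<in> carrier_vec n" "y \<in> carrier_vec n" for x y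
  proof -
    have "vdist x y = 0 \<longleftrightarrow> vnorm (x - y) \<le> 0"
      using that vnorm_nonneg[of "x - y"] by (auto simp: vdist_def)
    also have "\<dots> \<longleftrightarrow> x = y"
      using that by (auto simp: vnorm_le_iff)
    finally show ?thesis .
  qed
  show "vdist x z \<le> vdist x y + vdist y z"
    if "x \<in> carrier_vec n" "y \<in> carrier_vec n" "z \<in> carrier_vec n" for x y z
  proof -
    have "\<bar>(x - z) $ i\<bar> \<le> vnorm (x - y) + vnorm (y - z)" if "i < n" for i
      using abs_index_le_vnorm[of i "x - y"] abs_index_le_vnorm[of i "y - z"] that
        \<open>x \<in> _\<close> \<open>y \<in> _\<close> \<open>z \<in> _\<close> by auto
    then show ?thesis
      using that by (simp add: vdist_def vnorm_le_iff vnorm_nonneg)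
  qed
qed

section \<open>Comparison functions and incremental input-to-state stability\<close>

definition class_K :: "(real \<Rightarrow> real) \<Rightarrow> bool" where
  "class_K \<gamma> \<longleftrightarrow> continuous_on {0..} \<gamma> \<and> strict_mono_on {0..} \<gamma> \<and> \<gamma> 0 = 0"

definition class_K_inf :: "(real \<Rightarrow> real) \<Rightarrow> bool" where
  "class_K_inf \<gamma> \<longleftrightarrow> class_K \<gamma> \<and> filterlim \<gamma> at_top at_top"

definition class_KL :: "(real \<Rightarrow> nat \<Rightarrow> real) \<Rightarrow> bool" where
  "class_KL \<psi> \<longleftrightarrow>
     continuous_on ({0..} \<times> UNIV) (\<lambda>(r, k). \<psi> r k) \<and>
     (\<forall>k. class_K (\<lambda>r. \<psi> r k)) \<and>
     (\<forall>r>0. (\<forall>j k. j < k \<longrightarrow> \<psi> r k < \<psi> r j) \<and> (\<lambda>k. \<psi> r k) \<longlonglongrightarrow> 0)"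

fun trajectory :: "('x \<Rightarrow> 'u \<Rightarrow> 'x) \<Rightarrow> 'x \<Rightarrow> (nat \<Rightarrow> 'u) \<Rightarrow> nat \<Rightarrow> 'x" where
  "trajectory w x0 u 0 = x0"
| "trajectory w x0 u (Suc k) = w (trajectory w x0 u k) (u k)"

(* n and m are the dimensions of the state and of the input. Only the entries of ua and ub
   at times z < k are constrained; the state at time k does not depend on the others. *)
definition delta_ISS ::
  "nat \<Rightarrow> nat \<Rightarrow> (real vec \<Rightarrow> real vec \<Rightarrow> real vec) \<Rightarrow> real vec set \<Rightarrow> real vec set \<Rightarrow> bool" where
  "delta_ISS n m w X U \<longleftrightarrow>
     compactin (vec_topology n) X \<and> (\<forall>x\<in>X. \<forall>u\<in>U. w x u \<in> X) \<and>
     compactin (vec_topology m) U \<and>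
     (\<exists>\<psi> \<gamma>. class_KL \<psi> \<and> class_K_inf \<gamma> \<and>
        (\<forall>k. \<forall>xa\<in>X. \<forall>xb\<in>X. \<forall>ua ub. (\<forall>z<k. ua z \<in> U) \<longrightarrow> (\<forall>z<k. ub z \<in> U) \<longrightarrow>
           vnorm (trajectory w xa ua k - trajectory w xb ub k)
             \<le> \<psi> (vnorm (xa - xb)) k
               + \<gamma> (Max (insert 0 ((\<lambda>z. vnorm (ua z - ub z)) ` {..<k})))))"

section \<open>MGU networks\<close>

definition sigmoid :: "real \<Rightarrow> real" where
  "sigmoid x = 1 / (1 + exp (- x))"

definition hadamard_vec :: "real vec \<Rightarrow> real vec \<Rightarrow> real vec" (infixl \<open>\<circ>\<^sub>v\<close> 70) where
  "v \<circ>\<^sub>v w = vec (dim_vec v) (\<lambda>i. v $ i * w $ i)"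

definition ones_vec :: "nat \<Rightarrow> real vec" where
  "ones_vec n = vec n (\<lambda>_. 1)"

(* The index h refers to the candidate state (h with a tilde). *)
record mgu_params =
  W_f :: "real mat"
  R_f :: "real mat"
  b_f :: "real vec"
  W_h :: "real mat"
  R_h :: "real mat"
  b_h :: "real vec"

definition mgu_dims :: "nat \<Rightarrow> nat \<Rightarrow> mgu_params \<Rightarrow> bool" where
  "mgu_dims n m p \<longleftrightarrow>
     W_f p \<in> carrier_mat n m \<and> R_f p \<in> carrier_mat n n \<and> b_f p \<in> carrier_vec n \<and>
     W_h p \<in> carrier_mat n m \<and> R_h p \<in> carrier_mat n n \<and> b_h p \<in> carrier_vec n"

definition forget_gate :: "mgu_params \<Rightarrow> real vec \<Rightarrow> real vec \<Rightarrow> real vec" where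
  "forget_gate p u h = map_vec sigmoid (W_f p *\<^sub>v u + R_f p *\<^sub>v h + b_f p)"

definition candidate_state :: "mgu_params \<Rightarrow> real vec \<Rightarrow> real vec \<Rightarrow> real vec" where
  "candidate_state p u h =
     map_vec tanh (W_h p *\<^sub>v u + R_h p *\<^sub>v (forget_gate p u h \<circ>\<^sub>v h) + b_h p)"

definition mgu_layer_step :: "mgu_params \<Rightarrow> real vec \<Rightarrow> real vec \<Rightarrow> real vec" where
  "mgu_layer_step p u h =
     (ones_vec (dim_vec h) - forget_gate p u h) \<circ>\<^sub>v h
     + forget_gate p u h \<circ>\<^sub>v candidate_state p u h"

(* nh l is the number of hidden units of layer l, for l = 1, ..., L. *)

definition layer_input_dim :: "nat \<Rightarrow> (nat \<Rightarrow> nat) \<Rightarrow> nat \<Rightarrow> nat" where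
  "layer_input_dim nu nh l = (if l = 1 then nu else nh (l - 1))"

definition state_dim :: "(nat \<Rightarrow> nat) \<Rightarrow> nat \<Rightarrow> nat" where
  "state_dim nh L = (\<Sum>l=1..L. nh l)"

(* The hidden state of layer l inside the stacked network state. *)
definition layer_state :: "(nat \<Rightarrow> nat) \<Rightarrow> real vec \<Rightarrow> nat \<Rightarrow> real vec" where
  "layer_state nh h l = vec (nh l) (\<lambda>i. h $ (state_dim nh (l - 1) + i))"

definition stack_layers :: "nat \<Rightarrow> (nat \<Rightarrow> real vec) \<Rightarrow> real vec" where
  "stack_layers L g = foldr (@\<^sub>v) (map g [1..<Suc L]) vNil"

(* For l >= 1 the value at l is the successor state of layer l, which is the input of layer
   l + 1 at the same time step; the value at 0 is the network input, i.e. the input of layer 1. *)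
fun next_layer_state ::
  "(nat \<Rightarrow> nat) \<Rightarrow> (nat \<Rightarrow> mgu_params) \<Rightarrow> real vec \<Rightarrow> real vec \<Rightarrow> nat \<Rightarrow> real vec" where
  "next_layer_state nh p h u 0 = u"
| "next_layer_state nh p h u (Suc l) =
     mgu_layer_step (p (Suc l)) (next_layer_state nh p h u l) (layer_state nh h (Suc l))"

definition mgu_network_step ::
  "nat \<Rightarrow> (nat \<Rightarrow> nat) \<Rightarrow> (nat \<Rightarrow> mgu_params) \<Rightarrow> real vec \<Rightarrow> real vec \<Rightarrow> real vec" where
  "mgu_network_step L nh p h u = stack_layers L (next_layer_state nh p h u)"

definition unit_box :: "nat \<Rightarrow> real vec set" where
  "unit_box n = {x \<in> carrier_vec n. \<forall>i<n. x $ i \<in> {-1..1}}"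

definition H_inv :: "nat \<Rightarrow> (nat \<Rightarrow> nat) \<Rightarrow> real vec set" where
  "H_inv L nh =
     {h \<in> carrier_vec (state_dim nh L). \<forall>l\<in>{1..L}. layer_state nh h l \<in> unit_box (nh l)}"

definition hconcat :: "real mat \<Rightarrow> real mat \<Rightarrow> real vec \<Rightarrow> real mat" where
  "hconcat W R b = mat_of_cols (dim_vec b) (cols W @ cols R @ [b])"

definition sigma_bar :: "mgu_params \<Rightarrow> real" where
  "sigma_bar p = sigmoid (mnorm (hconcat (W_f p) (R_f p) (b_f p)))"

definition phi_bar :: "mgu_params \<Rightarrow> real" where
  "phi_bar p = tanh (mnorm (hconcat (W_h p) (R_h p) (b_h p)))"

lemma stack_layers_Suc: "stack_layers (Suc L) g = stack_layers L g @\<^sub>v g (Suc L)"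
proof -
  have *: "foldr (@\<^sub>v) xs v = foldr (@\<^sub>v) xs vNil @\<^sub>v v" for xs and v :: "real vec"
  proof (induction xs)
    case (Cons x xs)
    have "x @\<^sub>v (a @\<^sub>v v) = (x @\<^sub>v a) @\<^sub>v v" for a
      by (intro eq_vecI) (auto simp: less_diff_conv add.commute)
    with Cons show ?case by simp
  qed simp
  have "v @\<^sub>v vNil = v" for v :: "real vec"
    by (intro eq_vecI) auto
  with *[of "map g [1..<Suc L]" "g (Suc L)"] show ?thesis
    by (simp add: stack_layers_def)
qed

lemma dim_stack_layers:
  "(\<And>l. l \<in> {1..L} \<Longrightarrow> dim_vec (g l) = nh l) \<Longrightarrow> dim_vec (stack_layers L g) = state_dim nh L"
proof (induction L)
  case 0
  then show ?case by (simp add: stack_layers_def state_dim_def)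
next
  case (Suc L)
  then show ?case by (simp add: stack_layers_Suc state_dim_def)
qed

lemma layer_state_stack_layers:
  assumes "\<And>l. l \<in> {1..L} \<Longrightarrow> dim_vec (g l) = nh l" and "l \<in> {1..L}"
  shows "layer_state nh (stack_layers L g) l = g l"
  using assms
proof (induction L)
  case (Suc L)
  have dim: "dim_vec (stack_layers L g) = state_dim nh L"
    using Suc.prems by (intro dim_stack_layers) auto
  show ?case
  proof (cases "l = Suc L")
    case True
    then show ?thesis
      using Suc.prems dim
      by (intro eq_vecI) (auto simp: layer_state_def stack_layers_Suc)
  next
    case False
    then have l: "l \<in> {1..L}" using Suc.prems by auto
    have "state_dim nh l \<le> state_dim nh L"
      using l unfolding state_dim_def by (intro sum_mono2) auto
    moreover have "state_dim nh l = state_dim nh (l - 1) + nh l"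
      using l by (cases l) (auto simp: state_dim_def)
    ultimately have "layer_state nh (stack_layers (Suc L) g) l = layer_state nh (stack_layers L g) l"
      using Suc.prems dim by (intro eq_vecI) (auto simp: layer_state_def stack_layers_Suc)
    then show ?thesis
      using Suc l by simp
  qed
qed simp

end

theory Submission
  imports Defs
begin

text \<open>
  The hypothesis says that every layer, taken alone with its input held fixed, contracts distances
  between states in the unit box. Write the difference of two successor states of one layer,
  componentwise, as

  \<open>(1 - f) (h - h') + (f - f') (c' - h') + f (c - c')\<close>

  with \<open>f\<close>, \<open>f'\<close> the gates and \<open>c\<close>, \<open>c'\<close> the candidate states. As long as inputs and states stay in
  the unit box, the gate lies between \<open>1 - sigma_bar\<close> and \<open>sigma_bar\<close> and the candidate is bounded by
  \<open>phi_bar\<close>; the sigmoid has Lipschitz constant 1/4 and \<open>tanh\<close> has Lipschitz constant 1. Inserting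
  these bounds gives \<open>|\<Delta>h_new| \<le> \<lambda> |\<Delta>h| + \<mu> |\<Delta>u|\<close>, in which \<open>\<lambda>\<close> is exactly the left-hand side of the
  hypothesis (\<open>mgu_layer_step_diff_le\<close>).

  In the network the input of layer \<open>l + 1\<close> is the new state of layer \<open>l\<close>, so the layers form a
  cascade. The gains \<open>\<mu>\<close> may be large, but a cascade has no feedback from later to earlier layers:
  weighting the distance in layer \<open>l\<close> by \<open>e ^ l\<close> multiplies every coupling by \<open>e\<close>, and for small \<open>e\<close>
  the largest weighted distance still contracts, at the rate \<open>q = (1 + a) / 2\<close> halfway between 1
  and the largest \<open>\<lambda>\<close>, called \<open>a\<close> (\<open>cascade_step_le\<close>). Iterating this over time sums a geometric
  series in the input difference and yields the linear comparison functions
  \<open>\<psi> r k = q ^ k * r / e ^ L\<close> and \<open>\<gamma> r = r / (e ^ L * (1 - q))\<close>.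
\<close>

section \<open>Lipschitz bounds for the activation functions\<close>

lemma lipschitz_of_derivative_bound:
  fixes f :: "real \<Rightarrow> real"
  assumes "\<And>x. (f has_real_derivative f' x) (at x)" and bound: "\<And>x. \<bar>f' x\<bar> \<le> B"
  shows "\<bar>f x - f y\<bar> \<le> B * \<bar>x - y\<bar>"
proof -
  have less: "\<bar>f b - f a\<bar> \<le> B * \<bar>b - a\<bar>" if "a < b" for a b
  proof -
    have "\<exists>z>a. z < b \<and> f b - f a = (b - a) * f' z"
      using that assms(1) by (intro MVT2) auto
    then obtain z where "f b - f a = (b - a) * f' z"
      by blast
    then show ?thesis
      using bound[of z] that by (simp add: abs_mult mult.commute mult_left_mono)
  qed
  show ?thesis
    using less[of x y] less[of y x] by (cases x y rule: linorder_cases) (auto simp: abs_minus_commute)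
qed

lemma sigmoid_mono: "x \<le> y \<Longrightarrow> sigmoid x \<le> sigmoid y"
  unfolding sigmoid_def by (intro frac_le) (auto simp: add_pos_pos)

lemma sigmoid_minus: "sigmoid (- x) = 1 - sigmoid x"
proof -
  have "1 + exp x \<noteq> 0" "1 + exp (- x) \<noteq> 0"
    by (smt (verit) exp_gt_zero)+
  then show ?thesis
    by (simp add: sigmoid_def field_simps flip: exp_add)
qed

lemma sigmoid_pos: "0 < sigmoid x"
  by (simp add: sigmoid_def add_pos_pos)

lemma sigmoid_less_1: "sigmoid x < 1"
  using sigmoid_pos[of "- x"] by (simp add: sigmoid_minus)

lemma sigmoid_has_derivative:
  "(sigmoid has_real_derivative sigmoid x * (1 - sigmoid x)) (at x)"
proof -
  have "1 + exp (- x) \<noteq> 0"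
    by (smt (verit) exp_gt_zero)
  then have "((\<lambda>x. 1 / (1 + exp (- x))) has_real_derivative sigmoid x * (1 - sigmoid x)) (at x)"
    by (auto intro!: derivative_eq_intros simp: sigmoid_def divide_simps)
  moreover have "sigmoid = (\<lambda>x. 1 / (1 + exp (- x)))"
    by (auto simp: sigmoid_def)
  ultimately show ?thesis
    by simp
qed

lemma sigmoid_lipschitz: "\<bar>sigmoid x - sigmoid y\<bar> \<le> 1 / 4 * \<bar>x - y\<bar>"
proof -
  have "\<bar>sigmoid x * (1 - sigmoid x)\<bar> \<le> 1 / 4" for x
  proof -
    have "0 \<le> (sigmoid x - 1 / 2)\<^sup>2"
      by simp
    then show ?thesis
      using sigmoid_pos[of x] sigmoid_less_1[of x]
      by (simp add: power2_eq_square algebra_simps abs_mult)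
  qed
  then show ?thesis
    by (rule lipschitz_of_derivative_bound[OF sigmoid_has_derivative])
qed

lemma tanh_lipschitz: "\<bar>tanh x - tanh y\<bar> \<le> \<bar>x - y\<bar>" for x y :: real
proof -
  have "\<bar>1 - tanh x ^ 2\<bar> \<le> 1" for x :: real
    using tanh_real_bounds[of x] by (simp add: abs_square_le_1 abs_le_iff)
  moreover have "(tanh has_real_derivative 1 - tanh x ^ 2) (at x)" for x :: real
    by (auto intro!: derivative_eq_intros)
  ultimately show ?thesis
    using lipschitz_of_derivative_bound[of tanh "\<lambda>x. 1 - tanh x ^ 2" 1 x y] by simp
qed

section \<open>The infinity norm of matrices acting on the unit box\<close>

lemma mnorm_nonneg: "0 \<le> mnorm A"
  unfolding mnorm_def by (intro Max_ge) auto

lemma row_sum_le_mnorm: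
  "i < dim_row A \<Longrightarrow> (\<Sum>j<dim_col A. \<bar>A $$ (i, j)\<bar>) \<le> mnorm A"
  unfolding mnorm_def by (intro Max_ge) auto

lemma mult_mat_vec_index_sum:
  assumes "A \<in> carrier_mat n m" "v \<in> carrier_vec m" "i < n"
  shows "(A *\<^sub>v v) $ i = (\<Sum>j<m. A $$ (i, j) * v $ j)"
  using assms by (auto simp: scalar_prod_def lessThan_atLeast0 intro!: sum.cong)

lemma abs_mult_mat_vec_diff_le:
  assumes "A \<in> carrier_mat n m" "v \<in> carrier_vec m" "w \<in> carrier_vec m" "i < n"
  shows "\<bar>(A *\<^sub>v v) $ i - (A *\<^sub>v w) $ i\<bar> \<le> mnorm A * vnorm (v - w)"
proof -
  have "\<bar>(A *\<^sub>v v) $ i - (A *\<^sub>v w) $ i\<bar> = \<bar>\<Sum>j<m. A $$ (i, j) * (v - w) $ j\<bar>"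
    using assms
    by (simp add: mult_mat_vec_index_sum right_diff_distrib del: index_mult_mat_vec flip: sum_subtractf)
  also have "\<dots> \<le> (\<Sum>j<m. \<bar>A $$ (i, j)\<bar> * vnorm (v - w))"
    using assms abs_index_le_vnorm[of _ "v - w"]
    by (intro order.trans[OF sum_abs] sum_mono) (auto simp: abs_mult intro!: mult_left_mono)
  also have "\<dots> \<le> mnorm A * vnorm (v - w)"
    using row_sum_le_mnorm[of i A] assms
    by (auto simp: sum_distrib_right[symmetric] vnorm_nonneg intro!: mult_right_mono)
  finally show ?thesis .
qed

lemma hconcat_row_sum:
  assumes "W \<in> carrier_mat n m" "R \<in> carrier_mat n k" "b \<in> carrier_vec n" "i < n"
  shows "(\<Sum>j<dim_col (hconcat W R b). \<bar>hconcat W R b $$ (i, j)\<bar>)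
    = (\<Sum>j<m. \<bar>W $$ (i, j)\<bar>) + (\<Sum>j<k. \<bar>R $$ (i, j)\<bar>) + \<bar>b $ i\<bar>"
proof -
  have cols: "sum_list (map (\<lambda>v. \<bar>v $ i\<bar>) (cols A)) = (\<Sum>j<c. \<bar>A $$ (i, j)\<bar>)"
    if "A \<in> carrier_mat n c" for A :: "real mat" and c
    using that \<open>i < n\<close>
    by (auto simp: cols_def comp_def interv_sum_list_conv_sum_set_nat lessThan_atLeast0 intro!: sum.cong)
  let ?cs = "cols W @ cols R @ [b]"
  have "(\<Sum>j<dim_col (hconcat W R b). \<bar>hconcat W R b $$ (i, j)\<bar>)
      = (\<Sum>j<length ?cs. \<bar>(?cs ! j) $ i\<bar>)"
    using assms by (intro sum.cong) (auto simp: hconcat_def mat_of_cols_def)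
  also have "\<dots> = sum_list (map (\<lambda>v. \<bar>v $ i\<bar>) ?cs)"
    by (simp only: sum_list_sum_nth length_map lessThan_atLeast0 nth_map cong: sum.cong_simp)
      (intro sum.cong, simp_all add: nth_map del: map_append)
  finally show ?thesis
    using cols assms by simp
qed

lemma unit_boxD: "v \<in> unit_box n \<Longrightarrow> i < n \<Longrightarrow> \<bar>v $ i\<bar> \<le> 1"
  by (auto simp: unit_box_def abs_le_iff minus_le_iff)

lemma unit_boxI: "v \<in> carrier_vec n \<Longrightarrow> (\<And>i. i < n \<Longrightarrow> \<bar>v $ i\<bar> \<le> 1) \<Longrightarrow> v \<in> unit_box n"
  by (force simp: unit_box_def abs_le_iff)

lemma unit_box_carrier: "v \<in> unit_box n \<Longrightarrow> v \<in> carrier_vec n"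
  by (simp add: unit_box_def)

text \<open>On the unit box the affine map inside an activation is the concatenated matrix applied to
  \<open>(u, v, 1)\<close>, a vector of norm at most 1, so a single row sum bounds it.\<close>

lemma abs_affine_le_mnorm_hconcat:
  assumes "W \<in> carrier_mat n m" "R \<in> carrier_mat n k" "b \<in> carrier_vec n"
    and "u \<in> unit_box m" "v \<in> unit_box k" "i < n"
  shows "\<bar>(W *\<^sub>v u + R *\<^sub>v v + b) $ i\<bar> \<le> mnorm (hconcat W R b)"
proof -
  have mult: "\<bar>(A *\<^sub>v x) $ i\<bar> \<le> (\<Sum>j<c. \<bar>A $$ (i, j)\<bar>)"
    if "A \<in> carrier_mat n c" "x \<in> unit_box c" for A x c
  proof -
    have "\<bar>(A *\<^sub>v x) $ i\<bar> = \<bar>\<Sum>j<c. A $$ (i, j) * x $ j\<bar>"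
      using mult_mat_vec_index_sum[of A n c x i] that \<open>i < n\<close> by (simp add: unit_box_carrier)
    also have "\<dots> \<le> (\<Sum>j<c. \<bar>A $$ (i, j)\<bar>)"
      using that unit_boxD[of x c]
      by (intro order.trans[OF sum_abs] sum_mono) (auto simp: abs_mult intro!: mult_left_le)
    finally show ?thesis .
  qed
  have "\<bar>(W *\<^sub>v u + R *\<^sub>v v + b) $ i\<bar> \<le> \<bar>(W *\<^sub>v u) $ i\<bar> + \<bar>(R *\<^sub>v v) $ i\<bar> + \<bar>b $ i\<bar>"
    using assms by (simp del: index_mult_mat_vec)
  also have "\<dots> \<le> (\<Sum>j<m. \<bar>W $$ (i, j)\<bar>) + (\<Sum>j<k. \<bar>R $$ (i, j)\<bar>) + \<bar>b $ i\<bar>"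
    using mult assms by (intro add_mono) auto
  also have "\<dots> = (\<Sum>j<dim_col (hconcat W R b). \<bar>hconcat W R b $$ (i, j)\<bar>)"
    using assms hconcat_row_sum by simp
  also have "\<dots> \<le> mnorm (hconcat W R b)"
    using assms by (intro row_sum_le_mnorm) (auto simp: hconcat_def)
  finally show ?thesis .
qed

lemma abs_affine_diff_le:
  assumes "W \<in> carrier_mat n m" "R \<in> carrier_mat n k" "b \<in> carrier_vec n"
    and "u \<in> carrier_vec m" "u' \<in> carrier_vec m" "v \<in> carrier_vec k" "v' \<in> carrier_vec k" "i < n"
  shows "\<bar>(W *\<^sub>v u + R *\<^sub>v v + b) $ i - (W *\<^sub>v u' + R *\<^sub>v v' + b) $ i\<bar>
    \<le> mnorm W * vnorm (u - u') + mnorm R * vnorm (v - v')"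
proof -
  have "(W *\<^sub>v u + R *\<^sub>v v + b) $ i - (W *\<^sub>v u' + R *\<^sub>v v' + b) $ i
      = ((W *\<^sub>v u) $ i - (W *\<^sub>v u') $ i) + ((R *\<^sub>v v) $ i - (R *\<^sub>v v') $ i)"
    using assms by (simp del: index_mult_mat_vec)
  then show ?thesis
    using abs_mult_mat_vec_diff_le[of W n m u u' i] abs_mult_mat_vec_diff_le[of R n k v v' i] assms
    by linarith
qed

section \<open>Incremental gain of a single layer\<close>

definition contraction_rate :: "mgu_params \<Rightarrow> real" where
  "contraction_rate p =
     sigma_bar p + (sigma_bar p)\<^sup>2 * mnorm (R_h p)
     + 1 / 4 * mnorm (R_f p) * (sigma_bar p * mnorm (R_h p) + phi_bar p + 1)"

text \<open>An input difference reaches the new state through the candidate with the gate fixed (first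
  summand) and through the gate (second summand). The first carries only one factor \<open>sigma_bar\<close>,
  against two in the contraction rate, because the input enters the candidate ungated.\<close>

definition input_gain :: "mgu_params \<Rightarrow> real" where
  "input_gain p =
     sigma_bar p * mnorm (W_h p)
     + 1 / 4 * mnorm (W_f p) * (sigma_bar p * mnorm (R_h p) + phi_bar p + 1)"

lemma sigma_bar_pos: "0 < sigma_bar p"
  by (simp add: sigma_bar_def sigmoid_pos)

lemma phi_bar_nonneg: "0 \<le> phi_bar p"
  by (simp add: phi_bar_def mnorm_nonneg)

lemma contraction_rate_nonneg: "0 \<le> contraction_rate p"
  unfolding contraction_rate_def
  using sigma_bar_pos[of p] phi_bar_nonneg[of p] by (simp add: mnorm_nonneg)

lemma input_gain_nonneg: "0 \<le> input_gain p"
  unfolding input_gain_def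
  using sigma_bar_pos[of p] phi_bar_nonneg[of p] by (simp add: mnorm_nonneg)

context
  fixes n m :: nat and p :: mgu_params
  assumes dims: "mgu_dims n m p"
begin

lemma forget_gate_carrier: "forget_gate p u h \<in> carrier_vec n"
  using dims by (intro carrier_vecI) (simp add: mgu_dims_def forget_gate_def)

lemma candidate_state_carrier: "candidate_state p u h \<in> carrier_vec n"
  using dims by (intro carrier_vecI) (simp add: mgu_dims_def candidate_state_def)

lemma forget_gate_index:
  "i < n \<Longrightarrow> forget_gate p u h $ i = sigmoid ((W_f p *\<^sub>v u + R_f p *\<^sub>v h + b_f p) $ i)"
  unfolding forget_gate_def
  using dims by (intro index_map_vec(1)) (auto simp: mgu_dims_def)

lemma candidate_state_index:
  "i < n \<Longrightarrow> candidate_state p u h $ i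
     = tanh ((W_h p *\<^sub>v u + R_h p *\<^sub>v (forget_gate p u h \<circ>\<^sub>v h) + b_h p) $ i)"
  unfolding candidate_state_def
  using dims by (intro index_map_vec(1)) (auto simp: mgu_dims_def)

lemma gated_state_carrier: "forget_gate p u h \<circ>\<^sub>v h \<in> carrier_vec n"
  using forget_gate_carrier[of u h] by (auto simp: hadamard_vec_def)

lemma gated_state_index:
  "i < n \<Longrightarrow> (forget_gate p u h \<circ>\<^sub>v h) $ i = forget_gate p u h $ i * h $ i"
  using forget_gate_carrier[of u h] by (auto simp: hadamard_vec_def)

lemma forget_gate_unit_interval: "i < n \<Longrightarrow> 0 < forget_gate p u h $ i \<and> forget_gate p u h $ i < 1"
  by (simp add: forget_gate_index sigmoid_pos sigmoid_less_1 del: index_mult_mat_vec)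

lemma mgu_layer_step_carrier: "h \<in> carrier_vec n \<Longrightarrow> mgu_layer_step p u h \<in> carrier_vec n"
  using forget_gate_carrier[of u h]
  by (auto simp: mgu_layer_step_def hadamard_vec_def)

lemma mgu_layer_step_index:
  "h \<in> carrier_vec n \<Longrightarrow> i < n \<Longrightarrow> mgu_layer_step p u h $ i
     = (1 - forget_gate p u h $ i) * h $ i + forget_gate p u h $ i * candidate_state p u h $ i"
  using forget_gate_carrier[of u h] candidate_state_carrier[of u h]
  by (auto simp: mgu_layer_step_def hadamard_vec_def ones_vec_def)

text \<open>The lower bound is the upper one reflected by \<open>sigmoid (- x) = 1 - sigmoid x\<close>. It is what
  makes the leakage factor \<open>1 - f\<close> at most \<open>sigma_bar\<close> as well.\<close>

lemma forget_gate_bounds: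
  assumes "u \<in> unit_box m" "h \<in> unit_box n" "i < n"
  shows "1 - sigma_bar p \<le> forget_gate p u h $ i" "forget_gate p u h $ i \<le> sigma_bar p"
proof -
  let ?z = "(W_f p *\<^sub>v u + R_f p *\<^sub>v h + b_f p) $ i"
  let ?N = "mnorm (hconcat (W_f p) (R_f p) (b_f p))"
  have "\<bar>?z\<bar> \<le> ?N"
    using dims assms abs_affine_le_mnorm_hconcat by (auto simp: mgu_dims_def simp del: index_mult_mat_vec)
  then have "sigmoid (- ?N) \<le> sigmoid ?z" "sigmoid ?z \<le> sigmoid ?N"
    by (intro sigmoid_mono; linarith)+
  then show "1 - sigma_bar p \<le> forget_gate p u h $ i" "forget_gate p u h $ i \<le> sigma_bar p"
    using assms by (simp_all add: forget_gate_index sigma_bar_def sigmoid_minus del: index_mult_mat_vec)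
qed

lemma gated_state_unit_box:
  assumes "h \<in> unit_box n"
  shows "forget_gate p u h \<circ>\<^sub>v h \<in> unit_box n"
proof (rule unit_boxI[OF gated_state_carrier])
  fix i assume "i < n"
  then show "\<bar>(forget_gate p u h \<circ>\<^sub>v h) $ i\<bar> \<le> 1"
    using forget_gate_unit_interval[of i u h] unit_boxD[OF assms, of i]
    by (simp add: gated_state_index abs_mult mult_le_one)
qed

lemma abs_candidate_state_le:
  assumes "u \<in> unit_box m" "h \<in> unit_box n" "i < n"
  shows "\<bar>candidate_state p u h $ i\<bar> \<le> phi_bar p"
proof -
  have "\<bar>(W_h p *\<^sub>v u + R_h p *\<^sub>v (forget_gate p u h \<circ>\<^sub>v h) + b_h p) $ i\<bar>
      \<le> mnorm (hconcat (W_h p) (R_h p) (b_h p))"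
    using dims assms gated_state_unit_box
    by (intro abs_affine_le_mnorm_hconcat) (auto simp: mgu_dims_def)
  then show ?thesis
    using assms by (simp add: candidate_state_index phi_bar_def flip: tanh_real_abs del: index_mult_mat_vec)
qed

text \<open>Each component of the new state is a convex combination of the old one and the candidate.\<close>

lemma mgu_layer_step_unit_box:
  assumes "u \<in> unit_box m" "h \<in> unit_box n"
  shows "mgu_layer_step p u h \<in> unit_box n"
proof (rule unit_boxI)
  show "mgu_layer_step p u h \<in> carrier_vec n"
    using assms by (simp add: mgu_layer_step_carrier unit_box_carrier)
  fix i assume i: "i < n"
  let ?f = "forget_gate p u h $ i" and ?c = "candidate_state p u h $ i"
  have f: "0 < ?f" "?f < 1"
    using forget_gate_unit_interval i by auto
  have c: "\<bar>?c\<bar> \<le> 1"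
    using abs_candidate_state_le[OF assms i] tanh_real_lt_1 by (smt (verit) phi_bar_def)
  have "\<bar>(1 - ?f) * h $ i + ?f * ?c\<bar> \<le> (1 - ?f) * \<bar>h $ i\<bar> + ?f * \<bar>?c\<bar>"
    using f by (intro order.trans[OF abs_triangle_ineq]) (simp add: abs_mult)
  also have "\<dots> \<le> (1 - ?f) * 1 + ?f * 1"
    using f c unit_boxD[OF assms(2) i] by (intro add_mono mult_left_mono) auto
  finally show "\<bar>mgu_layer_step p u h $ i\<bar> \<le> 1"
    using assms i by (simp add: mgu_layer_step_index unit_box_carrier)
qed

text \<open>Replacing the factors of the three-term decomposition one at a time, and bounding the gated
  state in the same way, accounts for every term of the contraction rate: \<open>sigma_bar\<close> is the
  leakage, \<open>sigma_bar\<^sup>2 * mnorm (R_h p)\<close> the path through the candidate with the gate fixed, and the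
  terms with \<open>mnorm (R_f p)\<close> come from the variation of the gate.\<close>

lemma mgu_layer_step_diff_le:
  assumes u: "u \<in> unit_box m" "u' \<in> unit_box m" and h: "h \<in> unit_box n" "h' \<in> unit_box n"
  shows "vnorm (mgu_layer_step p u h - mgu_layer_step p u' h')
    \<le> contraction_rate p * vnorm (h - h') + input_gain p * vnorm (u - u')"
proof -
  note carrier = u[THEN unit_box_carrier] h[THEN unit_box_carrier]
  define D where "D = vnorm (h - h')"
  define E where "E = vnorm (u - u')"
  define s where "s = sigma_bar p"
  \<comment> \<open>\<open>P\<close> bounds the variation of the gate; the factor 1/4 is the Lipschitz constant of the sigmoid.\<close>
  define P where "P = 1 / 4 * (mnorm (W_f p) * E + mnorm (R_f p) * D)"
  define f where "f = forget_gate p u h"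
  define f' where "f' = forget_gate p u' h'"
  define c where "c = candidate_state p u h"
  define c' where "c' = candidate_state p u' h'"
  have nonneg: "0 \<le> D" "0 \<le> E" "0 \<le> s" "0 \<le> P"
    using sigma_bar_pos[of p] by (auto simp: D_def E_def s_def P_def vnorm_nonneg mnorm_nonneg)
  have hdiff: "\<bar>h $ i - h' $ i\<bar> \<le> D" if "i < n" for i
    using abs_index_le_vnorm[of i "h - h'"] that carrier by (simp add: D_def)
  have fs: "\<bar>f $ i\<bar> \<le> s" "\<bar>1 - f $ i\<bar> \<le> s" if "i < n" for i
    using forget_gate_bounds[OF u(1) h(1) that] forget_gate_unit_interval[OF that, of u h]
    by (auto simp: f_def s_def)
  have fdiff: "\<bar>f $ i - f' $ i\<bar> \<le> P" if "i < n" for i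
  proof -
    let ?z = "(W_f p *\<^sub>v u + R_f p *\<^sub>v h + b_f p) $ i"
    let ?z' = "(W_f p *\<^sub>v u' + R_f p *\<^sub>v h' + b_f p) $ i"
    have "\<bar>?z - ?z'\<bar> \<le> mnorm (W_f p) * E + mnorm (R_f p) * D"
      unfolding D_def E_def
      using dims carrier that by (intro abs_affine_diff_le) (auto simp: mgu_dims_def)
    then show ?thesis
      using sigmoid_lipschitz[of ?z ?z'] that
      by (simp add: f_def f'_def P_def forget_gate_index del: index_mult_mat_vec)
  qed
  have gdiff: "vnorm (f \<circ>\<^sub>v h - f' \<circ>\<^sub>v h') \<le> s * D + P"
  proof -
    have "\<bar>(f \<circ>\<^sub>v h - f' \<circ>\<^sub>v h') $ i\<bar> \<le> s * D + P" if i: "i < n" for i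
    proof -
      have "(f \<circ>\<^sub>v h - f' \<circ>\<^sub>v h') $ i = f $ i * (h $ i - h' $ i) + (f $ i - f' $ i) * h' $ i"
        using i gated_state_carrier[of u' h']
        by (auto simp: f_def f'_def gated_state_index algebra_simps)
      also have "\<bar>\<dots>\<bar> \<le> \<bar>f $ i\<bar> * \<bar>h $ i - h' $ i\<bar> + \<bar>f $ i - f' $ i\<bar> * \<bar>h' $ i\<bar>"
        by (intro order.trans[OF abs_triangle_ineq]) (simp add: abs_mult)
      also have "\<dots> \<le> s * D + P * 1"
        using fs[OF i] hdiff[OF i] fdiff[OF i] unit_boxD[OF h(2) i] nonneg
        by (intro add_mono mult_mono) auto
      finally show ?thesis
        by simp
    qed
    then show ?thesis
      using nonneg gated_state_carrier[of u' h'] by (subst vnorm_le_iff) (auto simp: f'_def)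
  qed
  have cdiff: "\<bar>c $ i - c' $ i\<bar> \<le> mnorm (W_h p) * E + mnorm (R_h p) * (s * D + P)" if "i < n" for i
  proof -
    let ?z = "(W_h p *\<^sub>v u + R_h p *\<^sub>v (f \<circ>\<^sub>v h) + b_h p) $ i"
    let ?z' = "(W_h p *\<^sub>v u' + R_h p *\<^sub>v (f' \<circ>\<^sub>v h') + b_h p) $ i"
    have "\<bar>?z - ?z'\<bar> \<le> mnorm (W_h p) * E + mnorm (R_h p) * vnorm (f \<circ>\<^sub>v h - f' \<circ>\<^sub>v h')"
      unfolding E_def
      using dims carrier that gated_state_carrier
      by (intro abs_affine_diff_le) (auto simp: mgu_dims_def f_def f'_def)
    also have "\<dots> \<le> mnorm (W_h p) * E + mnorm (R_h p) * (s * D + P)"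
      using gdiff by (intro add_left_mono mult_left_mono) (auto simp: mnorm_nonneg)
    finally show ?thesis
      using tanh_lipschitz[of ?z ?z'] that
      by (simp add: c_def c'_def f_def f'_def candidate_state_index del: index_mult_mat_vec)
  qed
  let ?Q = "mnorm (W_h p) * E + mnorm (R_h p) * (s * D + P)"
  have total: "s * D + P * (1 + phi_bar p) + s * ?Q = contraction_rate p * D + input_gain p * E"
    by (simp add: contraction_rate_def input_gain_def P_def s_def power2_eq_square field_simps)
  have "\<bar>(mgu_layer_step p u h - mgu_layer_step p u' h') $ i\<bar> \<le> contraction_rate p * D + input_gain p * E"
    if i: "i < n" for i
  proof -
    have "(mgu_layer_step p u h - mgu_layer_step p u' h') $ i
        = (1 - f $ i) * (h $ i - h' $ i) + (f $ i - f' $ i) * (c' $ i - h' $ i) + f $ i * (c $ i - c' $ i)"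
      using i carrier mgu_layer_step_carrier[of h' u']
      by (auto simp: f_def f'_def c_def c'_def mgu_layer_step_index algebra_simps)
    also have "\<bar>\<dots>\<bar> \<le> \<bar>1 - f $ i\<bar> * \<bar>h $ i - h' $ i\<bar> + \<bar>f $ i - f' $ i\<bar> * \<bar>c' $ i - h' $ i\<bar>
        + \<bar>f $ i\<bar> * \<bar>c $ i - c' $ i\<bar>"
      by (simp only: abs_mult[symmetric])
    also have "\<dots> \<le> s * D + P * (1 + phi_bar p) + s * ?Q"
    proof -
      have "\<bar>c' $ i - h' $ i\<bar> \<le> 1 + phi_bar p"
        using unit_boxD[OF h(2) i] abs_candidate_state_le[OF u(2) h(2) i] by (simp add: c'_def)
      then have "\<bar>f $ i - f' $ i\<bar> * \<bar>c' $ i - h' $ i\<bar> \<le> P * (1 + phi_bar p)"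
        using fdiff[OF i] nonneg by (intro mult_mono) auto
      moreover have "\<bar>1 - f $ i\<bar> * \<bar>h $ i - h' $ i\<bar> \<le> s * D"
        using fs[OF i] hdiff[OF i] nonneg by (intro mult_mono) auto
      moreover have "\<bar>f $ i\<bar> * \<bar>c $ i - c' $ i\<bar> \<le> s * ?Q"
        using fs[OF i] cdiff[OF i] nonneg by (intro mult_mono) auto
      ultimately show ?thesis
        by linarith
    qed
    finally show ?thesis
      by (simp only: total)
  qed
  then show ?thesis
    using nonneg carrier mgu_layer_step_carrier[of h' u'] contraction_rate_nonneg[of p] input_gain_nonneg[of p]
    by (subst vnorm_le_iff) (auto simp: D_def E_def)
qed

end

section \<open>Stacked states and their layers\<close>

lemma state_dim_pred: "1 \<le> l \<Longrightarrow> state_dim nh l = state_dim nh (l - 1) + nh l"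
  by (cases l) (auto simp: state_dim_def)

lemma layer_index_less:
  assumes "l \<in> {1..L}" "j < nh l"
  shows "state_dim nh (l - 1) + j < state_dim nh L"
proof -
  have "state_dim nh l \<le> state_dim nh L"
    using assms unfolding state_dim_def by (intro sum_mono2) auto
  then show ?thesis
    using assms state_dim_pred[of l nh] by auto
qed

lemma layer_index_exists:
  "i < state_dim nh L \<Longrightarrow> \<exists>l\<in>{1..L}. \<exists>j<nh l. i = state_dim nh (l - 1) + j"
proof (induction L)
  case 0
  then show ?case by (simp add: state_dim_def)
next
  case (Suc L)
  show ?case
  proof (cases "i < state_dim nh L")
    case True
    then obtain l j where "l \<in> {1..L}" "j < nh l" "i = state_dim nh (l - 1) + j"
      using Suc.IH by blast
    then show ?thesis
      by (intro bexI[of _ l] exI[of _ j]) auto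
  next
    case False
    then show ?thesis
      using Suc.prems state_dim_pred[of "Suc L" nh]
      by (intro bexI[of _ "Suc L"] exI[of _ "i - state_dim nh L"]) auto
  qed
qed

lemma all_index_iff_layers:
  "(\<forall>i<state_dim nh L. P i) \<longleftrightarrow> (\<forall>l\<in>{1..L}. \<forall>j<nh l. P (state_dim nh (l - 1) + j))"
  using layer_index_less layer_index_exists by blast

text \<open>The infinity norm of a stacked vector is the maximum of the norms of its blocks. The
  formulation by upper bounds avoids a maximum over layers.\<close>

lemma vnorm_le_iff_layers:
  assumes "h \<in> carrier_vec (state_dim nh L)" "h' \<in> carrier_vec (state_dim nh L)" "0 \<le> c"
  shows "vnorm (h - h') \<le> c \<longleftrightarrow> (\<forall>l\<in>{1..L}. vnorm (layer_state nh h l - layer_state nh h' l) \<le> c)"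
proof -
  have "vnorm (h - h') \<le> c \<longleftrightarrow> (\<forall>i<state_dim nh L. \<bar>h $ i - h' $ i\<bar> \<le> c)"
    using assms by (auto simp: vnorm_le_iff)
  also have "\<dots> \<longleftrightarrow> (\<forall>l\<in>{1..L}. \<forall>j<nh l.
      \<bar>h $ (state_dim nh (l - 1) + j) - h' $ (state_dim nh (l - 1) + j)\<bar> \<le> c)"
    by (rule all_index_iff_layers)
  also have "\<dots> \<longleftrightarrow> (\<forall>l\<in>{1..L}. vnorm (layer_state nh h l - layer_state nh h' l) \<le> c)"
    using assms by (simp add: vnorm_le_iff layer_state_def)
  finally show ?thesis .
qed

text \<open>This reduces compactness of the invariant set to compactness of a single box.\<close>

lemma H_inv_eq_unit_box: "H_inv L nh = unit_box (state_dim nh L)"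
proof -
  have "(\<forall>l\<in>{1..L}. layer_state nh h l \<in> unit_box (nh l)) \<longleftrightarrow> (\<forall>i<state_dim nh L. h $ i \<in> {-1..1})" for h
  proof -
    have "(\<forall>l\<in>{1..L}. layer_state nh h l \<in> unit_box (nh l))
        \<longleftrightarrow> (\<forall>l\<in>{1..L}. \<forall>j<nh l. h $ (state_dim nh (l - 1) + j) \<in> {-1..1})"
      by (simp add: unit_box_def layer_state_def)
    also have "\<dots> \<longleftrightarrow> (\<forall>i<state_dim nh L. h $ i \<in> {-1..1})"
      by (rule all_index_iff_layers[symmetric])
    finally show ?thesis .
  qed
  then show ?thesis
    by (auto simp: H_inv_def unit_box_def)
qed

section \<open>Compactness of the unit box\<close>

text \<open>Tychonoff makes the cube of functions \<open>{..<n} \<rightarrow> {-1..1}\<close> compact in the product topology, and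
  \<open>vec n\<close> maps it continuously onto the box.\<close>

lemma compactin_unit_box: "compactin (vec_topology n) (unit_box n)"
proof -
  interpret Metric_space "carrier_vec n" vdist
    by (rule Metric_space_vdist)
  let ?X = "product_topology (\<lambda>_. euclideanreal) {..<n}"
  have "continuous_map ?X mtopology (vec n)"
    unfolding continuous_map_to_metric
  proof (intro ballI allI impI)
    fix x :: "nat \<Rightarrow> real" and e :: real
    assume x: "x \<in> topspace ?X" and e: "0 < e"
    \<comment> \<open>The radius is halved because the componentwise bounds pass to the norm only as a weak
      inequality, while a metric ball is open.\<close>
    let ?U = "PiE {..<n} (\<lambda>i. ball (x i) (e / 2))"
    have "openin ?X ?U"
      by (simp add: openin_PiE)
    moreover have "x \<in> ?U"
      using x e by (auto simp: PiE_iff)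
    moreover have "vec n y \<in> mball (vec n x) e" if y: "y \<in> ?U" for y
    proof -
      have "\<bar>x i - y i\<bar> \<le> e / 2" if "i < n" for i
        using y that by (auto simp: PiE_iff dist_real_def dest!: bspec[where x = i])
      then have "vnorm (vec n x - vec n y) \<le> e / 2"
        using e by (subst vnorm_le_iff) auto
      then show ?thesis
        using e by (simp add: in_mball vdist_def)
    qed
    ultimately show "\<exists>U. openin ?X U \<and> x \<in> U \<and> (\<forall>y\<in>U. vec n y \<in> mball (vec n x) e)"
      by blast
  qed
  moreover have "compactin ?X (PiE {..<n} (\<lambda>_. {-1..1}))"
    by (simp add: compactin_PiE)
  ultimately have "compactin mtopology (vec n ` PiE {..<n} (\<lambda>_. {-1..1}))"
    by (rule image_compactin[rotated])
  moreover have "vec n ` PiE {..<n} (\<lambda>_. {-1..1}) = unit_box n"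
  proof (intro equalityI subsetI)
    fix v assume v: "v \<in> unit_box n"
    then have "v = vec n (restrict (($) v) {..<n})"
      by (intro eq_vecI) (auto simp: unit_box_def)
    moreover have "restrict (($) v) {..<n} \<in> PiE {..<n} (\<lambda>_. {-1..1})"
      using v by (auto simp: unit_box_def)
    ultimately show "v \<in> vec n ` PiE {..<n} (\<lambda>_. {-1..1})"
      by blast
  next
    fix v assume "v \<in> vec n ` PiE {..<n} (\<lambda>_. {-1..1 :: real})"
    then obtain x where x: "v = vec n x" "x \<in> PiE {..<n} (\<lambda>_. {-1..1})"
      by blast
    have "x i \<in> {-1..1}" if "i < n" for i
      using PiE_mem[OF x(2), of i] that by simp
    then show "v \<in> unit_box n"
      by (simp add: x(1) unit_box_def)
  qed
  ultimately show ?thesis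
    unfolding vec_topology_def by (simp only:)
qed

section \<open>Trajectories and linear comparison functions\<close>

lemma trajectory_in_invariant_set:
  assumes "\<And>x u. x \<in> X \<Longrightarrow> u \<in> U \<Longrightarrow> w x u \<in> X" and "x0 \<in> X" "\<forall>z<k. u z \<in> U"
  shows "trajectory w x0 u k \<in> X"
  using assms(3) by (induction k) (auto intro: assms)

lemma class_KL_geometric:
  assumes "0 < C" "0 < q" "q < 1"
  shows "class_KL (\<lambda>r k. C * q ^ k * r)"
proof -
  have "continuous_on ({0..} \<times> (UNIV :: nat set)) (\<lambda>(r, k). C * q ^ k * r)"
  proof -
    have "continuous_on UNIV (\<lambda>k :: nat. q ^ k)"
      by (rule continuous_on_discrete)
    then have "continuous_on ({0..} \<times> (UNIV :: nat set)) (\<lambda>z. q ^ snd z)"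
      by (rule continuous_on_compose2) (auto intro!: continuous_intros)
    then show ?thesis
      by (auto simp: case_prod_unfold intro!: continuous_intros)
  qed
  moreover have "class_K (\<lambda>r. C * q ^ k * r)" for k
    using assms by (auto simp: class_K_def strict_mono_on_def intro!: continuous_intros)
  moreover have "C * q ^ k * r < C * q ^ j * r" if "0 < r" "j < k" for r j k
    using assms that by (simp add: power_strict_decreasing)
  moreover have "(\<lambda>k. C * q ^ k * r) \<longlonglongrightarrow> 0" for r
    using assms by (auto intro!: tendsto_eq_intros LIMSEQ_power_zero)
  ultimately show ?thesis
    by (simp add: class_KL_def)
qed

lemma class_K_inf_linear: "0 < G \<Longrightarrow> class_K_inf (\<lambda>r. G * r)"
  by (auto simp: class_K_inf_def class_K_def strict_mono_on_def
      intro!: continuous_intros filterlim_tendsto_pos_mult_at_top[OF tendsto_const] filterlim_ident)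

section \<open>Contraction of a cascade in a weighted norm\<close>

text \<open>
  One time step of a cascade: \<open>d l\<close> and \<open>d' l\<close> stand for the distances in layer \<open>l\<close> before and after
  the step, and \<open>d' 0\<close> for the distance of the inputs. The assumption on \<open>e\<close> makes the weighted
  coupling \<open>e * g\<close> at most half of the contraction margin \<open>1 - a\<close>. With \<open>q = (1 + a) / 2\<close> the bound
  \<open>q * B + D\<close> for layer \<open>l\<close> then reproduces itself in layer \<open>l + 1\<close>, since
  \<open>a * B + (1 - a) / 2 * (q * B + D) \<le> q * B + D\<close>. So the number of layers does not enter the rate.
\<close>

lemma cascade_step_le:
  fixes d d' :: "nat \<Rightarrow> real"
  assumes first: "d' 0 \<le> D"
    and step: "\<And>l. l < L \<Longrightarrow> d' (Suc l) \<le> a * d (Suc l) + g * d' l"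
    and bound: "\<And>l. l \<in> {1..L} \<Longrightarrow> e ^ l * d l \<le> B"
    and "0 \<le> a" "a < 1" "0 \<le> g" "0 < e" "e * g \<le> (1 - a) / 2" "0 \<le> B" "0 \<le> D"
    and "l \<le> L"
  shows "e ^ l * d' l \<le> (1 + a) / 2 * B + D"
  using \<open>l \<le> L\<close>
proof (induction l)
  case 0
  have "0 \<le> (1 + a) / 2 * B"
    using assms by simp
  then show ?case
    using first by simp
next
  case (Suc l)
  let ?C = "(1 + a) / 2 * B + D"
  have C: "0 \<le> ?C" "?C \<le> B + D"
    using assms mult_right_mono[of "(1 + a) / 2" 1 B] by auto
  have "e ^ Suc l * d' (Suc l) \<le> e ^ Suc l * (a * d (Suc l) + g * d' l)"
    using step[of l] Suc.prems \<open>0 < e\<close> by (intro mult_left_mono) auto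
  also have "\<dots> = a * (e ^ Suc l * d (Suc l)) + (e * g) * (e ^ l * d' l)"
    by (simp add: algebra_simps)
  also have "\<dots> \<le> a * B + (e * g) * ?C"
    using bound[of "Suc l"] Suc assms by (intro add_mono mult_left_mono) auto
  also have "(e * g) * ?C \<le> (1 - a) / 2 * (B + D)"
    using assms C by (intro mult_mono) auto
  also have "a * B + (1 - a) / 2 * (B + D) \<le> ?C"
    using mult_right_mono[of "(1 - a) / 2" 1 D] assms by (simp add: field_simps)
  finally show ?case
    by simp
qed

section \<open>The network\<close>

context
  fixes L nu :: nat and nh :: "nat \<Rightarrow> nat" and p :: "nat \<Rightarrow> mgu_params"
  assumes dims: "\<And>l. l \<in> {1..L} \<Longrightarrow> mgu_dims (nh l) (layer_input_dim nu nh l) (p l)"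
begin

lemma layer_state_unit_box: "h \<in> H_inv L nh \<Longrightarrow> l \<in> {1..L} \<Longrightarrow> layer_state nh h l \<in> unit_box (nh l)"
  by (simp add: H_inv_def)

text \<open>The index \<open>Suc l\<close> reads the value at \<open>l\<close> as the input of the next layer, which covers the
  network input at \<open>l = 0\<close> and the new states of the layers uniformly.\<close>

lemma next_layer_state_unit_box:
  assumes "h \<in> H_inv L nh" "u \<in> unit_box nu" "l \<le> L"
  shows "next_layer_state nh p h u l \<in> unit_box (layer_input_dim nu nh (Suc l))"
  using \<open>l \<le> L\<close>
proof (induction l)
  case 0
  then show ?case
    using assms by (simp add: layer_input_dim_def)
next
  case (Suc l)
  have "mgu_layer_step (p (Suc l)) (next_layer_state nh p h u l) (layer_state nh h (Suc l)) \<in> unit_box (nh (Suc l))"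
    using Suc assms dims[of "Suc l"] layer_state_unit_box[of h "Suc l"]
    by (intro mgu_layer_step_unit_box) auto
  then show ?case
    by (simp add: layer_input_dim_def)
qed

lemma dim_next_layer_state:
  assumes "h \<in> H_inv L nh" "u \<in> unit_box nu" "l \<in> {1..L}"
  shows "dim_vec (next_layer_state nh p h u l) = nh l"
  using next_layer_state_unit_box[of h u l] assms
  by (auto simp: layer_input_dim_def dest: unit_box_carrier)

lemma layer_state_network_step:
  assumes "h \<in> H_inv L nh" "u \<in> unit_box nu" "l \<in> {1..L}"
  shows "layer_state nh (mgu_network_step L nh p h u) l = next_layer_state nh p h u l"
  unfolding mgu_network_step_def
  using assms by (intro layer_state_stack_layers dim_next_layer_state) auto

lemma mgu_network_step_H_inv:
  assumes "h \<in> H_inv L nh" "u \<in> unit_box nu"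
  shows "mgu_network_step L nh p h u \<in> H_inv L nh"
proof -
  have "mgu_network_step L nh p h u \<in> carrier_vec (state_dim nh L)"
    unfolding mgu_network_step_def
    using assms by (intro carrier_vecI dim_stack_layers dim_next_layer_state) auto
  moreover have "layer_state nh (mgu_network_step L nh p h u) l \<in> unit_box (nh l)" if "l \<in> {1..L}" for l
    using next_layer_state_unit_box[of h u l] that assms
    by (simp add: layer_state_network_step layer_input_dim_def split: if_splits)
  ultimately show ?thesis
    by (simp add: H_inv_def)
qed

lemma next_layer_state_diff_le:
  assumes h: "h \<in> H_inv L nh" "h' \<in> H_inv L nh" and u: "u \<in> unit_box nu" "u' \<in> unit_box nu" and "l < L"
  shows "vnorm (next_layer_state nh p h u (Suc l) - next_layer_state nh p h' u' (Suc l))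
    \<le> contraction_rate (p (Suc l)) * vnorm (layer_state nh h (Suc l) - layer_state nh h' (Suc l))
      + input_gain (p (Suc l)) * vnorm (next_layer_state nh p h u l - next_layer_state nh p h' u' l)"
proof -
  have "l \<le> L" "Suc l \<in> {1..L}"
    using \<open>l < L\<close> by auto
  then show ?thesis
    using mgu_layer_step_diff_le[OF dims[of "Suc l"]] next_layer_state_unit_box layer_state_unit_box h u
    by simp
qed

text \<open>The bound \<open>B j = q ^ j * r + D / (1 - q)\<close> solves the recursion \<open>B (j + 1) = q * B j + D\<close> that
  one step of the cascade imposes on the weighted layer distances, and starts above \<open>r\<close>, the
  distance of the initial states. Returning to the unweighted norm costs the factor \<open>1 / e ^ L\<close>, the
  reciprocal of the smallest weight.\<close>

lemma network_trajectory_diff_le: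
  fixes a g e q :: real
  assumes rates: "\<And>l. l \<in> {1..L} \<Longrightarrow> contraction_rate (p l) \<le> a"
    and gains: "\<And>l. l \<in> {1..L} \<Longrightarrow> input_gain (p l) \<le> g"
    and a: "0 \<le> a" "a < 1" and "0 \<le> g" and e: "0 < e" "e \<le> 1" "e * g \<le> (1 - a) / 2"
    and q: "q = (1 + a) / 2"
    and h: "h \<in> H_inv L nh" "h' \<in> H_inv L nh"
    and u: "\<forall>z<k. u z \<in> unit_box nu" "\<forall>z<k. u' z \<in> unit_box nu"
    and D: "\<forall>z<k. vnorm (u z - u' z) \<le> D" "0 \<le> D"
  shows "vnorm (trajectory (mgu_network_step L nh p) h u k - trajectory (mgu_network_step L nh p) h' u' k)
    \<le> (q ^ k * vnorm (h - h') + D / (1 - q)) / e ^ L"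
proof -
  let ?w = "mgu_network_step L nh p"
  let ?x = "\<lambda>k. trajectory ?w h u k" and ?x' = "\<lambda>k. trajectory ?w h' u' k"
  define d where "d j l = vnorm (layer_state nh (?x j) l - layer_state nh (?x' j) l)" for j l
  define B where "B j = q ^ j * vnorm (h - h') + D / (1 - q)" for j
  have q01: "0 < q" "q < 1"
    using a q by auto
  have B_nonneg: "0 \<le> B j" for j
    using q01 D by (simp add: B_def vnorm_nonneg)
  have B_Suc: "q * B j + D = B (Suc j)" for j
    using q01 by (simp add: B_def field_simps)
  have inv: "?x j \<in> H_inv L nh" "?x' j \<in> H_inv L nh" if "j \<le> k" for j
    using that h u mgu_network_step_H_inv
    by (auto intro!: trajectory_in_invariant_set[where U = "unit_box nu"])
  have carrier: "h \<in> carrier_vec (state_dim nh L)" if "h \<in> H_inv L nh" for h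
    using that by (simp add: H_inv_def)
  have weighted: "e ^ l * d j l \<le> B j" if "j \<le> k" "l \<in> {1..L}" for j l
    using that
  proof (induction j arbitrary: l)
    case 0
    have "e ^ l * d 0 l \<le> 1 * vnorm (h - h')"
      using 0 e vnorm_le_iff_layers[of h nh L h' "vnorm (h - h')"] carrier h
      by (intro mult_mono power_le_one) (auto simp: d_def vnorm_nonneg)
    also have "\<dots> \<le> B 0"
      using q01 D by (simp add: B_def)
    finally show ?case .
  next
    case (Suc j)
    then have j: "j < k" by simp
    define d' where "d' l = vnorm (next_layer_state nh p (?x j) (u j) l - next_layer_state nh p (?x' j) (u' j) l)" for l
    have "e ^ l * d' l \<le> (1 + a) / 2 * B j + D"
    proof (rule cascade_step_le[where L = L and d = "d j" and g = g])
      show "d' 0 \<le> D"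
        using D j by (simp add: d'_def)
      show "d' (Suc i) \<le> a * d j (Suc i) + g * d' i" if "i < L" for i
      proof -
        have "d' (Suc i) \<le> contraction_rate (p (Suc i)) * d j (Suc i) + input_gain (p (Suc i)) * d' i"
          using next_layer_state_diff_le[OF inv(1)[of j] inv(2)[of j], of "u j" "u' j" i] that j u
          by (simp add: d_def d'_def)
        also have "\<dots> \<le> a * d j (Suc i) + g * d' i"
          using rates[of "Suc i"] gains[of "Suc i"] that
          by (intro add_mono mult_right_mono) (auto simp: d_def d'_def vnorm_nonneg)
        finally show ?thesis .
      qed
      show "e ^ i * d j i \<le> B j" if "i \<in> {1..L}" for i
        using Suc.IH that j by simp
    qed (use a e \<open>0 \<le> g\<close> D B_nonneg Suc.prems in auto)
    moreover have "d' l = d (Suc j) l"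
      using Suc.prems inv[of j] u j by (simp add: d_def d'_def layer_state_network_step)
    ultimately show ?case
      by (simp add: B_Suc flip: q)
  qed
  have "d k l \<le> B k / e ^ L" if l: "l \<in> {1..L}" for l
  proof -
    have "e ^ L * d k l \<le> e ^ l * d k l"
      using l e by (intro mult_right_mono power_decreasing) (auto simp: d_def vnorm_nonneg)
    also have "\<dots> \<le> B k"
      using weighted l by simp
    finally show ?thesis
      using e by (simp add: field_simps)
  qed
  then show ?thesis
    using vnorm_le_iff_layers[OF carrier[OF inv(1)[of k]] carrier[OF inv(2)[of k]], of "B k / e ^ L"]
      B_nonneg[of k] e
    by (simp add: d_def B_def)
qed

end

theorem theorem4:
  fixes L nu :: nat
    and nh :: "nat \<Rightarrow> nat"
    and p :: "nat \<Rightarrow> mgu_params"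
  assumes "1 \<le> L"
    and "\<And>l. l \<in> {1..L} \<Longrightarrow> mgu_dims (nh l) (layer_input_dim nu nh l) (p l)"
    and "\<And>l. l \<in> {1..L} \<Longrightarrow>
      sigma_bar (p l) + (sigma_bar (p l))\<^sup>2 * mnorm (R_h (p l))
      + 1 / 4 * mnorm (R_f (p l))
          * (sigma_bar (p l) * mnorm (R_h (p l)) + phi_bar (p l) + 1) < 1"
  shows "delta_ISS (state_dim nh L) nu (mgu_network_step L nh p) (H_inv L nh) (unit_box nu)"
proof -
  have rate_less_1: "contraction_rate (p l) < 1" if "l \<in> {1..L}" for l
    using assms(3)[OF that] by (simp add: contraction_rate_def)
  define a where "a = Max ((\<lambda>l. contraction_rate (p l)) ` {1..L})"
  define g where "g = Max ((\<lambda>l. input_gain (p l)) ` {1..L})"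
  have rates: "contraction_rate (p l) \<le> a" and gains: "input_gain (p l) \<le> g" if "l \<in> {1..L}" for l
    using that by (auto simp: a_def g_def intro!: Max_ge)
  have "0 \<le> a" "0 \<le> g"
    using rates[of 1] gains[of 1] contraction_rate_nonneg[of "p 1"] input_gain_nonneg[of "p 1"] \<open>1 \<le> L\<close>
    by auto
  have "a < 1"
    using \<open>1 \<le> L\<close> rate_less_1 unfolding a_def by (subst Max_less_iff) auto
  \<comment> \<open>The summand 1 covers \<open>g = 0\<close> and ensures \<open>e \<le> 1\<close>, so that the weights \<open>e ^ l\<close> decrease.\<close>
  define e where "e = (1 - a) / (2 * (g + 1))"
  have e: "0 < e" "e \<le> 1" "e * g \<le> (1 - a) / 2"
    using \<open>0 \<le> a\<close> \<open>a < 1\<close> \<open>0 \<le> g\<close> by (auto simp: e_def divide_simps mult_left_mono)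
  define q where "q = (1 + a) / 2"
  have q: "0 < q" "q < 1"
    using \<open>0 \<le> a\<close> \<open>a < 1\<close> by (auto simp: q_def)
  let ?\<psi> = "\<lambda>r k. 1 / e ^ L * q ^ k * r" and ?\<gamma> = "\<lambda>r. 1 / (e ^ L * (1 - q)) * r"
  have bound: "vnorm (trajectory (mgu_network_step L nh p) xa ua k - trajectory (mgu_network_step L nh p) xb ub k)
      \<le> ?\<psi> (vnorm (xa - xb)) k + ?\<gamma> (Max (insert 0 ((\<lambda>z. vnorm (ua z - ub z)) ` {..<k})))"
    if "xa \<in> H_inv L nh" "xb \<in> H_inv L nh" "\<forall>z<k. ua z \<in> unit_box nu" "\<forall>z<k. ub z \<in> unit_box nu"
    for k xa xb ua ub
  proof -
    let ?D = "Max (insert 0 ((\<lambda>z. vnorm (ua z - ub z)) ` {..<k}))"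
    have D: "\<forall>z<k. vnorm (ua z - ub z) \<le> ?D" "0 \<le> ?D"
      by (auto intro!: Max_ge)
    show ?thesis
      using network_trajectory_diff_le[OF assms(2) rates gains \<open>0 \<le> a\<close> \<open>a < 1\<close> \<open>0 \<le> g\<close> e q_def that D]
      by (simp add: add_divide_distrib mult.commute)
  qed
  show ?thesis
    unfolding delta_ISS_def
  proof (intro conjI exI)
    show "compactin (vec_topology (state_dim nh L)) (H_inv L nh)"
      by (simp add: H_inv_eq_unit_box compactin_unit_box)
    show "\<forall>x\<in>H_inv L nh. \<forall>u\<in>unit_box nu. mgu_network_step L nh p x u \<in> H_inv L nh"
      using mgu_network_step_H_inv[OF assms(2)] by blast
    show "class_KL ?\<psi>"
      using e q by (intro class_KL_geometric) auto
    show "class_K_inf ?\<gamma>"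
      using e q by (intro class_K_inf_linear) auto
  qed (use bound compactin_unit_box in auto)
qed

end
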